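(* Let $\mathbb{H}_1,\mathbb{H}_2$ be Hilbert spaces over the same field (real or complex) and let $T\in\mathbb{L}(\mathbb{H}_1,\mathbb{H}_2)$ be such that $T$ is not a scalar multiple of an isometry. If both $M_T$ and $m_T$ are non-empty, then $m_T\subseteq (M_T)^{\perp}$.
   Context: $\mathbb{L}(\mathbb{H}_1,\mathbb{H}_2)$ is the space of bounded linear operators from $\mathbb{H}_1$ to $\mathbb{H}_2$, $S_{\mathbb{H}_1}$ is the unit sphere of $\mathbb{H}_1$. $M_T=\{x\in S_{\mathbb{H}_1}:\|Tx\|=\|T\|\}$ and $m_T=\{x\in S_{\mathbb{H}_1}:\|Tx\|=m(T)\}$, where $m(T)=\inf\{\|Tx\|:\|x\|=1\}$. $(M_T)^{\perp}=\{y\in\mathbb{H}_1:\langle y,x\rangle=0\text{ for all }x\in M_T\}$. "$T$ is a scalar multiple of an isometry" means there is a constant $c\ge 0$ with $\|Tx\|=c\|x\|$ for all $x\in\mathbb{H}_1$. *)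

theory Defs
  imports "HOL-Analysis.Analysis"
begin

text \<open>Real Hilbert spaces are the library sort \<open>{real_inner, complete_space}\<close>. The libraries have no
  complex inner product spaces, so these are introduced as a class over \<^class>\<open>real_inner\<close>: the real
  inner product is the real part of the complex one, hence the library norm, topology and
  completeness are those of the complex inner product, and \<open>{complex_inner, complete_space}\<close> is the
  sort of complex Hilbert spaces. The inner product is linear in its first argument; positive
  definiteness is inherited from \<^class>\<open>real_inner\<close>.\<close>

class complex_inner = real_inner +
  fixes scaleC :: "complex \<Rightarrow> 'a \<Rightarrow> 'a"
    and cinner :: "'a \<Rightarrow> 'a \<Rightarrow> complex"
  assumes scaleC_add_right: "scaleC a (x + y) = scaleC a x + scaleC a y"
    and scaleC_add_left: "scaleC (a + b) x = scaleC a x + scaleC b x"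
    and scaleC_scaleC: "scaleC a (scaleC b x) = scaleC (a * b) x"
    and scaleC_of_real: "scaleC (complex_of_real r) x = scaleR r x"
    and cinner_commute: "cinner x y = cnj (cinner y x)"
    and cinner_add_left: "cinner (x + y) z = cinner x z + cinner y z"
    and cinner_scaleC_left: "cinner (scaleC a x) y = a * cinner x y"
    and Re_cinner: "Re (cinner x y) = inner x y"

lemma norm_eq_sqrt_cinner: "norm (x :: 'a::complex_inner) = sqrt (Re (cinner x x))"
  by (simp add: Re_cinner norm_eq_sqrt_inner)

instantiation complex :: complex_inner
begin
definition "scaleC_complex (a::complex) (x::complex) = a * x"
definition "cinner_complex (x::complex) (y::complex) = x * cnj y"
instance
  by standard (auto simp: scaleC_complex_def cinner_complex_def algebra_simps scaleR_conv_of_real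
      inner_complex_def)
end

definition bounded_clinear :: "('a::complex_inner \<Rightarrow> 'b::complex_inner) \<Rightarrow> bool"
  where "bounded_clinear T \<longleftrightarrow> bounded_linear T \<and> (\<forall>a x. T (scaleC a x) = scaleC a (T x))"

definition corthogonal_comp :: "'a::complex_inner set \<Rightarrow> 'a set"
  where "corthogonal_comp W = {y. \<forall>x\<in>W. cinner y x = 0}"

text \<open>The following notions depend only on the norms and serve both scalar fields.\<close>

definition min_modulus :: "('a::real_normed_vector \<Rightarrow> 'b::real_normed_vector) \<Rightarrow> real"
  where "min_modulus T = (INF x\<in>sphere 0 1. norm (T x))"

definition norm_attaining :: "('a::real_normed_vector \<Rightarrow> 'b::real_normed_vector) \<Rightarrow> 'a set"
  where "norm_attaining T = {x \<in> sphere 0 1. norm (T x) = onorm T}"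

definition min_attaining :: "('a::real_normed_vector \<Rightarrow> 'b::real_normed_vector) \<Rightarrow> 'a set"
  where "min_attaining T = {x \<in> sphere 0 1. norm (T x) = min_modulus T}"

definition scalar_multiple_of_isometry ::
    "('a::real_normed_vector \<Rightarrow> 'b::real_normed_vector) \<Rightarrow> bool"
  where "scalar_multiple_of_isometry T \<longleftrightarrow> (\<exists>c\<ge>0. \<forall>x. norm (T x) = c * norm x)"

end

theory Submission
  imports Defs
begin

text \<open>The forms \<open>\<parallel>T\<parallel>\<^sup>2 \<langle>v, w\<rangle> - \<langle>T v, T w\<rangle>\<close> and
  \<open>\<langle>T v, T w\<rangle> - m(T)\<^sup>2 \<langle>v, w\<rangle>\<close> are positive semidefinite, and a vector on which the
  quadratic form vanishes lies in the kernel of the bilinear form. Hence, for \<open>x \<in> M\<^sub>T\<close> and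
  \<open>y \<in> m\<^sub>T\<close>, \<open>\<parallel>T\<parallel>\<^sup>2 \<langle>x, y\<rangle> = \<langle>T x, T y\<rangle> = m(T)\<^sup>2 \<langle>x, y\<rangle>\<close>; and \<open>\<parallel>T\<parallel> \<noteq> m(T)\<close>, since otherwise
  \<open>T\<close> would be a multiple of an isometry. In the complex case this gives
  \<open>Re \<langle>y, x\<rangle> = 0\<close>, and \<open>m\<^sub>T\<close> is invariant under multiplication by \<open>\<i>\<close>.\<close>

lemma linear_coeff_zero_if_nonneg:
  fixes a b :: real
  assumes "\<And>t. 0 \<le> 2 * t * b + t\<^sup>2 * a"
  shows "b = 0"
proof (rule ccontr)
  assume "b \<noteq> 0"
  define p where "p = \<bar>a\<bar> + 1"
  have "p > 0" "a < 2 * p" by (auto simp: p_def)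
  have "p\<^sup>2 * (2 * (- b / p) * b + (- b / p)\<^sup>2 * a) = b\<^sup>2 * (a - 2 * p)"
    using \<open>p > 0\<close> by (simp add: field_simps power2_eq_square)
  moreover have "b\<^sup>2 * (a - 2 * p) < 0"
    using \<open>b \<noteq> 0\<close> \<open>a < 2 * p\<close> by (simp add: mult_pos_neg)
  moreover have "0 \<le> p\<^sup>2 * (2 * (- b / p) * b + (- b / p)\<^sup>2 * a)"
    by (rule mult_nonneg_nonneg[OF zero_le_power2 assms])
  ultimately show False by linarith
qed

lemma semidefinite_kernel:
  fixes T :: "'a::real_inner \<Rightarrow> 'b::real_inner"
  assumes "linear T"
    and nonneg: "\<And>v. 0 \<le> a * (norm v)\<^sup>2 + b * (norm (T v))\<^sup>2"
    and zero: "a * (norm x)\<^sup>2 + b * (norm (T x))\<^sup>2 = 0"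
  shows "a * inner x z + b * inner (T x) (T z) = 0"
proof (rule linear_coeff_zero_if_nonneg)
  fix t :: real
  have "a * (norm (x + t *\<^sub>R z))\<^sup>2 + b * (norm (T (x + t *\<^sub>R z)))\<^sup>2
      = (a * (norm x)\<^sup>2 + b * (norm (T x))\<^sup>2)
        + 2 * t * (a * inner x z + b * inner (T x) (T z))
        + t\<^sup>2 * (a * (norm z)\<^sup>2 + b * (norm (T z))\<^sup>2)"
    unfolding power2_norm_eq_inner linear_add[OF \<open>linear T\<close>] linear_cmul[OF \<open>linear T\<close>]
    by (simp add: inner_add_left inner_add_right inner_commute algebra_simps power2_eq_square)
  then show "0 \<le> 2 * t * (a * inner x z + b * inner (T x) (T z))
      + t\<^sup>2 * (a * (norm z)\<^sup>2 + b * (norm (T z))\<^sup>2)"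
    using nonneg[of "x + t *\<^sub>R z"] zero by simp
qed

lemma min_modulus_nonneg:
  assumes "min_attaining T \<noteq> {}"
  shows "0 \<le> min_modulus T"
proof -
  obtain y where "norm (T y) = min_modulus T"
    using assms by (auto simp: min_attaining_def)
  then show ?thesis by (metis norm_ge_zero)
qed

lemma min_modulus_mult_le:
  assumes "linear T"
  shows "min_modulus T * norm v \<le> norm (T v)"
proof (cases "v = 0")
  case False
  have "min_modulus T \<le> norm (T (v /\<^sub>R norm v))"
    unfolding min_modulus_def using False
    by (intro cINF_lower) (auto intro: bdd_belowI2[of _ 0])
  then show ?thesis
    using False by (simp add: linear_cmul[OF assms] field_simps)
qed simp

lemma min_attaining_orthogonal_norm_attaining:
  fixes T :: "'a::real_inner \<Rightarrow> 'b::real_inner"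
  assumes T: "bounded_linear T" and not_isometry: "\<not> scalar_multiple_of_isometry T"
    and x: "x \<in> norm_attaining T" and y: "y \<in> min_attaining T"
  shows "inner x y = 0"
proof -
  define M m where "M = onorm T" and "m = min_modulus T"
  have lin: "linear T" by (rule bounded_linear.linear[OF T])
  have upper: "norm (T v) \<le> M * norm v" for v
    unfolding M_def by (rule onorm[OF T])
  have lower: "m * norm v \<le> norm (T v)" for v
    unfolding m_def by (rule min_modulus_mult_le[OF lin])
  have "0 \<le> M" unfolding M_def by (rule onorm_pos_le[OF T])
  have "0 \<le> m" unfolding m_def using y by (intro min_modulus_nonneg) auto
  have "M \<noteq> m"
  proof
    assume "M = m"
    then have "norm (T v) = M * norm v" for v using upper[of v] lower[of v] by simp
    then show False
      using not_isometry \<open>0 \<le> M\<close> by (auto simp: scalar_multiple_of_isometry_def)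
  qed
  have "M\<^sup>2 * inner x y + (- 1) * inner (T x) (T y) = 0"
  proof (rule semidefinite_kernel[OF lin])
    show "0 \<le> M\<^sup>2 * (norm v)\<^sup>2 + (- 1) * (norm (T v))\<^sup>2" for v
      using power_mono[OF upper[of v], of 2] by (simp add: power_mult_distrib)
    show "M\<^sup>2 * (norm x)\<^sup>2 + (- 1) * (norm (T x))\<^sup>2 = 0"
      using x by (simp add: norm_attaining_def M_def)
  qed
  moreover have "(- m\<^sup>2) * inner y x + 1 * inner (T y) (T x) = 0"
  proof (rule semidefinite_kernel[OF lin])
    show "0 \<le> (- m\<^sup>2) * (norm v)\<^sup>2 + 1 * (norm (T v))\<^sup>2" for v
      using power_mono[OF lower[of v], of 2] \<open>0 \<le> m\<close> by (simp add: power_mult_distrib)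
    show "(- m\<^sup>2) * (norm y)\<^sup>2 + 1 * (norm (T y))\<^sup>2 = 0"
      using y by (simp add: min_attaining_def m_def)
  qed
  ultimately have "(M\<^sup>2 - m\<^sup>2) * inner x y = 0"
    by (simp add: inner_commute algebra_simps)
  moreover have "M\<^sup>2 \<noteq> m\<^sup>2"
    using \<open>M \<noteq> m\<close> \<open>0 \<le> M\<close> \<open>0 \<le> m\<close> by simp
  ultimately show ?thesis by simp
qed

lemma norm_scaleC_ii: "norm (scaleC \<i> x) = norm (x :: 'a::complex_inner)"
proof -
  have "cinner (scaleC \<i> x) (scaleC \<i> x) = cinner x x"
    by (simp add: cinner_scaleC_left cinner_commute[of x "scaleC \<i> x"])
       (simp flip: cinner_commute mult.assoc)
  then show ?thesis by (simp add: norm_eq_sqrt_cinner)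
qed

lemma min_attaining_corthogonal_norm_attaining:
  fixes U :: "'a::complex_inner \<Rightarrow> 'b::complex_inner"
  assumes U: "bounded_clinear U" and not_isometry: "\<not> scalar_multiple_of_isometry U"
    and x: "x \<in> norm_attaining U" and y: "y \<in> min_attaining U"
  shows "cinner y x = 0"
proof -
  have lin: "bounded_linear U" and U_scaleC: "U (scaleC a v) = scaleC a (U v)" for a v
    using U by (auto simp: bounded_clinear_def)
  have Re_zero: "Re (cinner w x) = 0" if "w \<in> min_attaining U" for w
    using min_attaining_orthogonal_norm_attaining[OF lin not_isometry x that]
    by (simp add: Re_cinner inner_commute)
  have "scaleC \<i> y \<in> min_attaining U"
    using y by (simp add: min_attaining_def U_scaleC norm_scaleC_ii)
  from Re_zero[OF this] have "Im (cinner y x) = 0"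
    by (simp add: cinner_scaleC_left)
  with Re_zero[OF y] show ?thesis by (simp add: complex_eq_iff)
qed

theorem theorem3p1:
  fixes T :: "'a::{real_inner, complete_space} \<Rightarrow> 'b::{real_inner, complete_space}"
    and U :: "'c::{complex_inner, complete_space} \<Rightarrow> 'd::{complex_inner, complete_space}"
  shows "(bounded_linear T \<and> \<not> scalar_multiple_of_isometry T
            \<and> norm_attaining T \<noteq> {} \<and> min_attaining T \<noteq> {}
          \<longrightarrow> min_attaining T \<subseteq> orthogonal_comp (norm_attaining T))
       \<and> (bounded_clinear U \<and> \<not> scalar_multiple_of_isometry U
            \<and> norm_attaining U \<noteq> {} \<and> min_attaining U \<noteq> {}
          \<longrightarrow> min_attaining U \<subseteq> corthogonal_comp (norm_attaining U))"
  by (auto simp: orthogonal_comp_def orthogonal_def corthogonal_comp_def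
      min_attaining_orthogonal_norm_attaining min_attaining_corthogonal_norm_attaining)

end
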